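(* Let $g\in\mathcal{G}_1$. If $I_g = I_\phi$ for some $\phi\in(0,\pi)$, then $g=g_\phi$ (as elements of $\mathcal{G}_1$, i.e. almost everywhere with respect to area measure).
   Context: $\mathcal{G}_1$ denotes the set of (almost-everywhere) equivalence classes of compactly supported (i.e. with compact essential support) bounded measurable functions $g$ on the complex plane $\mathbb{C}$ satisfying $0\le g\le 1$. Here $a$ denotes area (Lebesgue) measure on $\mathbb{C}$. For $g\in\mathcal{G}_1$ define $$I_g = -\frac{1}{\pi}\int_{\mathbb{C}}\frac{g(u)}{\overline{(u+1)}\,(u-1)}\,da(u).$$ For $0<\theta<\pi$, let $D_\theta$ be the disc with center $i\cot\theta$ and radius $\csc\theta$ (its boundary circle passes through $-1$ and $1$), let $g_\theta=\chi_{D_\theta}$ be its characteristic function, and write $I_\theta = I_{g_\theta}$. *)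

theory Defs
  imports "HOL-Analysis.Analysis"
begin

(* Complement of the union of all open sets on which g vanishes almost everywhere. *)
definition ess_support :: "(complex \<Rightarrow> real) \<Rightarrow> complex set" where
  "ess_support g = - \<Union>{U. open U \<and> (AE u in lebesgue. u \<in> U \<longrightarrow> g u = 0)}"

(* The set of all representatives of the almost-everywhere classes in \<open>\<G>\<^sub>1\<close>.
   Every condition is invariant under changing g on a null set, so equality of
   classes is almost-everywhere equality of representatives. *)
definition G1 :: "(complex \<Rightarrow> real) set" where
  "G1 = {g. g \<in> borel_measurable lebesgue
          \<and> (AE u in lebesgue. 0 \<le> g u \<and> g u \<le> 1)
          \<and> compact (ess_support g)}"

(* The integrand is absolutely integrable for g in G1: its singularities at -1 and 1
   are of order 1 in real dimension 2. *)
definition I_of :: "(complex \<Rightarrow> real) \<Rightarrow> complex" where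
  "I_of g = - (1 / of_real pi) *
     (LINT u|lebesgue. of_real (g u) / (cnj (u + 1) * (u - 1)))"

definition disc :: "real \<Rightarrow> complex set" where
  "disc \<theta> = ball (\<i> * of_real (cot \<theta>)) (1 / sin \<theta>)"

definition g_disc :: "real \<Rightarrow> complex \<Rightarrow> real" where
  "g_disc \<theta> = indicat_real (disc \<theta>)"

end

theory Submission
  imports Defs
begin

text \<open>
  Write \<open>K u = 1 / (cnj (u + 1) * (u - 1))\<close>, so that \<open>I_of g\<close> is \<open>- 1 / pi\<close> times the integral of
  \<open>g * K\<close>. Geometrically, the argument of \<open>K u\<close> is determined by the angle under which \<open>u\<close> sees the
  segment from \<open>-1\<close> to \<open>1\<close>, so by the inscribed angle theorem it is constant on each arc of a circle
  through these two points. After multiplication by the unit constant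
  \<open>w = sin \<phi> - \<i> * cos \<phi>\<close>, the real part of \<open>w * K\<close> is negative on \<open>disc \<phi>\<close>,
  zero on its boundary circle, and positive outside (\<open>disc_iff_kernel_neg\<close>).

  The disc is therefore the unique minimiser of a linear functional on \<open>G1\<close> (a bathtub argument).
  Since \<open>0 \<le> g \<le> 1\<close>, the difference \<open>g - g_disc \<phi>\<close> is at most \<open>0\<close> on the disc and at
  least \<open>0\<close> off it, so \<open>(g - g_disc \<phi>) * Re (w * K)\<close> is nonnegative almost everywhere. Its
  integral is a real-linear function of \<open>I_of g - I_of (g_disc \<phi>) = 0\<close>, so the product vanishes
  almost everywhere. As \<open>Re (w * K)\<close> vanishes only on a circle, which is a null set, \<open>g\<close> and
  \<open>g_disc \<phi>\<close> agree almost everywhere.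

  Splitting the integral of the difference requires both integrals to converge absolutely. This is
  \<open>integrable_times_kernel\<close>: the singularities of \<open>K\<close> at \<open>-1\<close> and \<open>1\<close> are of first order, and \<open>1 / dist a u\<close> is
  locally integrable in the plane.
\<close>

definition kernel :: "complex \<Rightarrow> complex" where
  "kernel u = 1 / (cnj (u + 1) * (u - 1))"

text \<open>
  The layers \<open>(1/2) ^ Suc n \<le> dist a u < (1/2) ^ n\<close> fill the punctured unit disc, and on the
  \<open>n\<close>-th of them \<open>1 / dist a u\<close> is at most \<open>2 ^ Suc n\<close>.
\<close>

lemma inverse_dist_le_dyadic_sum:
  fixes a u :: complex
  assumes "u \<noteq> a"
  shows "ennreal (indicat_real (ball a 1) u / dist a u)
           \<le> (\<Sum>n. ennreal (2 ^ Suc n) * indicator (ball a ((1/2) ^ n)) u)"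
proof (cases "dist a u < 1")
  case True
  have pos: "0 < dist a u" using assms by simp
  \<comment> \<open>\<open>m\<close> is the index of the layer containing \<open>u\<close>.\<close>
  define m where "m = (LEAST n. (1/2) ^ Suc n \<le> dist a u)"
  obtain k where k: "(1/2::real) ^ k < dist a u"
    using real_arch_pow_inv[OF pos, of "1/2"] by auto
  have "(1/2::real) ^ Suc k \<le> (1/2) ^ k" by simp
  with k have "(1/2::real) ^ Suc k \<le> dist a u" by linarith
  then have lower: "(1/2) ^ Suc m \<le> dist a u"
    unfolding m_def by (rule LeastI)
  have upper: "dist a u < (1/2) ^ m"
  proof (cases m)
    case (Suc j)
    then have "\<not> (1/2) ^ Suc j \<le> dist a u"
      using not_less_Least[of j "\<lambda>n. (1/2) ^ Suc n \<le> dist a u"] unfolding m_def by simp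
    then show ?thesis using Suc by simp
  qed (use True in simp)
  have "1 / dist a u \<le> 2 ^ Suc m"
    using lower pos by (simp add: field_simps power_divide)
  then have "ennreal (indicat_real (ball a 1) u / dist a u)
      \<le> ennreal (2 ^ Suc m) * indicator (ball a ((1/2) ^ m)) u"
    using upper True by (simp add: ennreal_leI)
  also have "\<dots> \<le> (\<Sum>n. ennreal (2 ^ Suc n) * indicator (ball a ((1/2) ^ n)) u)"
    using sum_le_suminf[of "\<lambda>n. ennreal (2 ^ Suc n) * indicator (ball a ((1/2) ^ n)) u" "{m}"]
    by (simp only: finite.intros sum.insert sum.empty empty_iff not_False_eq_True add_0_right)
      simp
  finally show ?thesis .
qed simp

text \<open>
  The \<open>n\<close>-th disc of the dyadic bound has area \<open>pi / 4 ^ n\<close> and weight \<open>2 ^ Suc n\<close>, which gives a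
  convergent geometric series.
\<close>

lemma integrable_inverse_dist_unit_ball:
  fixes a :: complex
  shows "integrable lebesgue (\<lambda>u. indicat_real (ball a 1) u / dist a u)"
proof -
  have ball: "ennreal (2 ^ Suc n) * emeasure lborel (ball a ((1/2) ^ n)) = ennreal (2 * pi * (1/2) ^ n)"
    for n
  proof -
    have "2 ^ Suc n * (pi * ((1/2) ^ n)\<^sup>2) = 2 * pi * (1/2::real) ^ n"
      by (simp add: field_simps power2_eq_square)
    then show ?thesis
      by (simp add: emeasure_ball unit_ball_vol_2 flip: ennreal_mult)
  qed
  have "(\<integral>\<^sup>+ u. ennreal (indicat_real (ball a 1) u / dist a u) \<partial>lborel)
      \<le> (\<integral>\<^sup>+ u. (\<Sum>n. ennreal (2 ^ Suc n) * indicator (ball a ((1/2) ^ n)) u) \<partial>lborel)"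
    by (rule nn_integral_mono_AE)
      (use AE_lborel_singleton[of a] inverse_dist_le_dyadic_sum in \<open>auto elim: eventually_mono\<close>)
  also have "\<dots> = (\<Sum>n. ennreal (2 ^ Suc n) * emeasure lborel (ball a ((1/2) ^ n)))"
  proof (subst nn_integral_suminf)
    show "(\<Sum>n. \<integral>\<^sup>+ u. ennreal (2 ^ Suc n) * indicator (ball a ((1/2) ^ n)) u \<partial>lborel)
        = (\<Sum>n. ennreal (2 ^ Suc n) * emeasure lborel (ball a ((1/2) ^ n)))"
      by (intro suminf_cong nn_integral_cmult_indicator) simp
  qed (auto intro!: borel_measurable_times_ennreal borel_measurable_indicator)
  also have "\<dots> = ennreal (\<Sum>n. 2 * pi * (1/2) ^ n)"
    unfolding ball by (intro suminf_ennreal2 summable_mult summable_geometric) auto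
  finally have "(\<integral>\<^sup>+ u. ennreal (indicat_real (ball a 1) u / dist a u) \<partial>lborel) < \<infinity>"
    by (simp add: le_less_trans)
  moreover have meas: "(\<lambda>u. indicat_real (ball a 1) u / dist a u) \<in> borel_measurable lborel"
    by (intro borel_measurable_divide borel_measurable_indicator borel_measurable_dist) auto
  ultimately have "integrable lborel (\<lambda>u. indicat_real (ball a 1) u / dist a u)"
    by (intro integrableI_nonneg) auto
  then show ?thesis
    using meas by (subst integrable_completion) auto
qed

text \<open>
  The product of the two reciprocal distances is at most their sum because the distances
  from \<open>u\<close> to \<open>1\<close> and \<open>-1\<close> add up to at least \<open>2\<close>. This separates the two singularities.
\<close>

lemma norm_kernel_le: "norm (kernel u) \<le> 1 / dist 1 u + 1 / dist (- 1) u"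
proof (cases "u = 1 \<or> u = - 1")
  case True
  then show ?thesis by (auto simp: kernel_def)
next
  case False
  have norm: "norm (kernel u) = 1 / (dist (- 1) u * dist 1 u)"
    unfolding kernel_def norm_divide norm_mult complex_mod_cnj
    by (simp add: dist_norm norm_minus_commute)
  have "1 \<le> dist (- 1) u + dist 1 u"
    using dist_triangle2[of "- 1" 1 u] by (simp add: dist_norm)
  moreover have "0 < dist (- 1) u" "0 < dist 1 u"
    using False by auto
  ultimately show ?thesis
    unfolding norm by (simp add: field_simps)
qed

text \<open>
  Away from the unit disc around \<open>a\<close> the function \<open>1 / dist a u\<close> is at most \<open>1\<close>; hence the
  product is dominated by a multiple of the indicator of a large disc plus two integrable
  local singularities.
\<close>

lemma integrable_times_kernel:
  assumes meas: "f \<in> borel_measurable lebesgue"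
    and bound: "AE u in lebesgue. \<bar>f u\<bar> \<le> 1"
    and supp: "AE u in lebesgue. u \<notin> S \<longrightarrow> f u = 0"
    and "bounded S"
  shows "integrable lebesgue (\<lambda>u. of_real (f u) * kernel u)"
proof -
  obtain R where R: "S \<subseteq> cball 0 R"
    using \<open>bounded S\<close> by (auto simp: bounded_iff subset_iff)
  define p where "p a u = indicat_real (ball a 1) u / dist a u" for a u :: complex
  have p: "1 / dist a u \<le> 1 + p a u" for a u
    by (cases "dist a u < 1")
      (auto simp: p_def dist_norm norm_minus_commute divide_simps split: split_indicator)
  let ?G = "\<lambda>u. 2 * indicat_real (cball 0 R) u + (p 1 u + p (- 1) u)"
  show ?thesis
  proof (rule Bochner_Integration.integrable_bound)
    have "integrable lebesgue (indicat_real (cball (0::complex) R))"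
      by (intro integrable_real_indicator) (auto simp: emeasure_lborel_cball_finite simp flip: infinity_ennreal_def)
    then show "integrable lebesgue ?G"
      unfolding p_def
      by (intro Bochner_Integration.integrable_add integrable_mult_right integrable_inverse_dist_unit_ball)
    have "kernel \<in> borel_measurable lebesgue"
      unfolding kernel_def
      by (intro measurable_completion borel_measurable_divide borel_measurable_times
          borel_measurable_const)
        (auto intro!: borel_measurable_continuous_onI continuous_intros)
    then show "(\<lambda>u. of_real (f u) * kernel u) \<in> borel_measurable lebesgue"
      using meas by measurable
    show "AE u in lebesgue. norm (of_real (f u) * kernel u) \<le> norm (?G u)"
      using bound supp
    proof eventually_elim
      case (elim u)
      show ?case
      proof (cases "u \<in> S")
        case True
        have "norm (of_real (f u) * kernel u) \<le> 1 * norm (kernel u)"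
          unfolding norm_mult using elim(1) by (intro mult_right_mono) auto
        also have "\<dots> \<le> 2 + (p 1 u + p (- 1) u)"
          using norm_kernel_le[of u] p[of 1 u] p[of "- 1" u] by linarith
        also have "\<dots> \<le> norm (?G u)"
          using True R by (auto simp: indicator_def)
        finally show ?thesis .
      qed (use elim in simp)
    qed
  qed
qed

text \<open>
  The complement of the essential support is a union of possibly uncountably many open sets;
  by the Lindelof property countably many of them already cover it, and countably many null
  sets have a null union.
\<close>

lemma AE_zero_off_ess_support:
  "AE u in lebesgue. u \<notin> ess_support g \<longrightarrow> g u = 0"
proof -
  let ?F = "{U. open U \<and> (AE u in lebesgue. u \<in> U \<longrightarrow> g u = 0)}"
  obtain F' where F': "F' \<subseteq> ?F" "countable F'" "\<Union>F' = \<Union>?F"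
    using Lindelof[of ?F] by auto
  have "AE u in lebesgue. \<forall>U\<in>F'. u \<in> U \<longrightarrow> g u = 0"
    using F' by (subst AE_ball_countable) auto
  then show ?thesis
    by eventually_elim (use F'(3) in \<open>auto simp: ess_support_def\<close>)
qed

text \<open>
  With \<open>u = x + \<i> * y\<close> one has \<open>cnj (u + 1) * (u - 1) = (x\<^sup>2 + y\<^sup>2 - 1) + 2 * \<i> * y\<close>. The equation
  of any circle through \<open>-1\<close> and \<open>1\<close> is a real-linear relation between these two coordinates,
  and the constant multiplying the kernel is chosen to produce the relation for the boundary
  of \<open>disc \<theta>\<close>.
\<close>

lemma Re_rotated_kernel:
  assumes "sin \<theta> \<noteq> 0"
  shows "Re (Complex (sin \<theta>) (- cos \<theta>) * kernel u) =
    sin \<theta> * ((dist (\<i> * of_real (cot \<theta>)) u)\<^sup>2 - (1 / sin \<theta>)\<^sup>2) / (norm (u + 1) * norm (u - 1))\<^sup>2"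
proof -
  obtain x y where u: "u = Complex x y" by (cases u)
  have pyth: "cos \<theta> ^ 2 = 1 - sin \<theta> ^ 2" by (simp add: cos_squared_eq)
  let ?P = "Complex (x\<^sup>2 + y\<^sup>2 - 1) (2 * y)"
  have P: "cnj (u + 1) * (u - 1) = ?P"
    by (simp add: u complex_eq_iff power2_eq_square algebra_simps)
  have normP: "(norm (u + 1) * norm (u - 1))\<^sup>2 = (norm ?P)\<^sup>2"
    by (metis P complex_mod_cnj norm_mult)
  have dist: "(dist (\<i> * of_real (cot \<theta>)) u)\<^sup>2 = x\<^sup>2 + (cot \<theta> - y)\<^sup>2"
    by (simp add: u dist_norm cmod_power2)
  have csc: "(1 / sin \<theta>)\<^sup>2 = 1 + (cot \<theta>)\<^sup>2"
    using assms by (simp add: cot_def pyth power_divide field_simps)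
  have sc: "sin \<theta> * cot \<theta> = cos \<theta>"
    using assms by (simp add: cot_def)
  have num: "sin \<theta> * ((dist (\<i> * of_real (cot \<theta>)) u)\<^sup>2 - (1 / sin \<theta>)\<^sup>2)
      = sin \<theta> * (x\<^sup>2 + y\<^sup>2 - 1) - cos \<theta> * (2 * y)"
    unfolding dist csc sc[symmetric] by (simp add: power2_eq_square algebra_simps)
  show ?thesis
    unfolding num normP kernel_def P
    by (simp add: Re_divide cmod_power2 Im_divide)
qed

text \<open>
  At \<open>u = 1\<close> and \<open>u = - 1\<close> the kernel has the value \<open>0\<close>, since division by \<open>0\<close> gives \<open>0\<close>. Both points
  lie on the boundary circle, so the sign rule holds at every point of the plane.
\<close>

lemma disc_iff_kernel_neg:
  assumes "0 < \<theta>" "\<theta> < pi"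
  shows "u \<in> disc \<theta> \<longleftrightarrow> Re (Complex (sin \<theta>) (- cos \<theta>) * kernel u) < 0"
    and "u \<in> sphere (\<i> * of_real (cot \<theta>)) (1 / sin \<theta>)
           \<longleftrightarrow> Re (Complex (sin \<theta>) (- cos \<theta>) * kernel u) = 0"
proof -
  let ?c = "\<i> * of_real (cot \<theta>)" and ?N = "(norm (u + 1) * norm (u - 1))\<^sup>2"
  have s: "sin \<theta> > 0" using assms by (rule sin_gt_zero)
  note Re = Re_rotated_kernel[of \<theta> u]
  have pm: "u \<in> sphere ?c (1 / sin \<theta>)" if "u = 1 \<or> u = - 1"
  proof -
    have "(dist ?c u)\<^sup>2 = 1 + (cot \<theta>)\<^sup>2"
      using that by (auto simp: dist_norm cmod_power2)
    also have "\<dots> = (1 / sin \<theta>)\<^sup>2"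
      using s by (simp add: cot_def power_divide field_simps)
    finally show ?thesis
      using s by (simp add: power2_eq_iff_nonneg)
  qed
  have pos: "?N > 0" if "\<not> (u = 1 \<or> u = - 1)"
    using that by (simp add: add_eq_0_iff2)
  have sq: "(dist ?c u)\<^sup>2 < (1 / sin \<theta>)\<^sup>2 \<longleftrightarrow> dist ?c u < 1 / sin \<theta>"
      "(dist ?c u)\<^sup>2 = (1 / sin \<theta>)\<^sup>2 \<longleftrightarrow> dist ?c u = 1 / sin \<theta>"
    using s power_mono_iff[of "1 / sin \<theta>" "dist ?c u" 2]
    by (simp_all only: not_le[symmetric] power2_eq_iff_nonneg zero_le_dist
        zero_less_divide_1_iff less_imp_le)
       simp_all
  show "u \<in> disc \<theta> \<longleftrightarrow> Re (Complex (sin \<theta>) (- cos \<theta>) * kernel u) < 0"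
  proof (cases "u = 1 \<or> u = - 1")
    case True
    then show ?thesis using pm by (auto simp: disc_def kernel_def)
  next
    case False
    then show ?thesis
      using pos s Re sq(1) by (simp add: disc_def divide_less_0_iff mult_less_0_iff)
  qed
  show "u \<in> sphere ?c (1 / sin \<theta>) \<longleftrightarrow> Re (Complex (sin \<theta>) (- cos \<theta>) * kernel u) = 0"
  proof (cases "u = 1 \<or> u = - 1")
    case True
    then show ?thesis using pm by (auto simp: kernel_def)
  next
    case False
    then show ?thesis
      using pos s Re sq(2) by simp
  qed
qed

theorem proposition2p3:
  fixes g :: "complex \<Rightarrow> real" and \<phi> :: real
  assumes "g \<in> G1"
    and "0 < \<phi>" and "\<phi> < pi"
    and "I_of g = I_of (g_disc \<phi>)"
  shows "AE u in lebesgue. g u = g_disc \<phi> u"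
proof -
  define w where "w = Complex (sin \<phi>) (- cos \<phi>)"
  define h where "h u = (g u - g_disc \<phi> u) * Re (w * kernel u)" for u
  have g: "g \<in> borel_measurable lebesgue" "AE u in lebesgue. 0 \<le> g u \<and> g u \<le> 1"
      "bounded (ess_support g)"
    using assms(1) by (auto simp: G1_def compact_imp_bounded)
  have intg: "integrable lebesgue (\<lambda>u. of_real (g u) * kernel u)"
    using g AE_zero_off_ess_support[of g]
    by (intro integrable_times_kernel[where S = "ess_support g"]) auto
  have intd: "integrable lebesgue (\<lambda>u. of_real (g_disc \<phi> u) * kernel u)"
    by (rule integrable_times_kernel[where S = "disc \<phi>"]) (auto simp: g_disc_def disc_def intro!: borel_measurable_indicator)
  have I: "I_of f = - (1 / of_real pi) * (LINT u|lebesgue. of_real (f u) * kernel u)" for f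
    by (simp add: I_of_def kernel_def)
  have h_eq: "h u = Re (w * (of_real (g u) * kernel u - of_real (g_disc \<phi> u) * kernel u))" for u
    by (simp add: h_def algebra_simps)
  have int: "integrable lebesgue
      (\<lambda>u. w * (of_real (g u) * kernel u - of_real (g_disc \<phi> u) * kernel u))"
    using intg intd by (intro integrable_mult_right Bochner_Integration.integrable_diff)
  have "(LINT u|lebesgue. h u)
      = Re (LINT u|lebesgue. w * (of_real (g u) * kernel u - of_real (g_disc \<phi> u) * kernel u))"
    unfolding h_eq using int by (rule integral_Re)
  also have "\<dots> = 0"
    using intg intd assms(4) by (simp add: I)
  finally have "(LINT u|lebesgue. h u) = 0" .
  moreover have "integrable lebesgue h"
    unfolding h_eq using int by (rule integrable_Re)
  moreover have "AE u in lebesgue. 0 \<le> h u"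
    using g(2)
  proof eventually_elim
    case (elim u)
    then show ?case
      using disc_iff_kernel_neg(1)[OF assms(2,3), of u]
      by (cases "u \<in> disc \<phi>")
        (auto simp: h_def g_disc_def w_def not_less intro: mult_nonneg_nonneg mult_nonpos_nonpos)
  qed
  ultimately have "AE u in lebesgue. h u = 0"
    using integral_nonneg_eq_0_iff_AE by blast
  moreover have "AE u in lebesgue. u \<notin> sphere (\<i> * of_real (cot \<phi>)) (1 / sin \<phi>)"
    using negligible_sphere negligible_iff_null_sets AE_not_in by blast
  ultimately show ?thesis
    by eventually_elim (use disc_iff_kernel_neg(2)[OF assms(2,3)] in \<open>auto simp: h_def w_def\<close>)
qed

end
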